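(* Let $\kappa>\aleph_0$ be a cardinal and let $\Gamma$ be a locally infinite primitive graph of cardinality $\kappa$ (i.e. $|V(\Gamma)|=\kappa$). If $\Gamma$ has infinite diameter, then its distance sequence is $1,\kappa,\kappa,\dots$ (that is, $d(0)=1$ and $d(i)=\kappa$ for all $i\ge 1$). If $\Gamma$ has finite diameter $n$, then its distance sequence is $1,\kappa,\dots,\kappa$, where $\kappa$ appears $n$ times (that is, $d(0)=1$ and $d(i)=\kappa$ for all $1\le i\le n$).
   Context: Graphs are simple and undirected, with vertex set $V(\Gamma)$. A graph is locally infinite if its vertices have infinite degree. A graph $\Gamma$ is primitive if its automorphism group acts primitively on $V(\Gamma)$, i.e. the only equivalence relations on $V(\Gamma)$ invariant under $\mathrm{Aut}(\Gamma)$ are the trivial ones (equality and the universal relation). A graph is vertex-transitive if any vertex can be mapped to any other by an automorphism. For a vertex-transitive graph, the distance sequence is $d(0),d(1),d(2),\dots$, where $d(i)$ is the (cardinal) number of vertices at graph distance exactly $i$ from a fixed vertex $v$; it does not depend on $v$. If the diameter is finite, equal to $n$, the sequence is the finite list $d(0),\dots,d(n)$. Locally infinite primitive graphs are vertex-transitive and connected, so this notion applies; infinite diameter means that finite distances are unbounded. *)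

theory Defs
  imports Main "HOL-Library.Extended_Nat"
begin

unbundle cardinal_syntax

text \<open>
  A simple undirected graph is a vertex set \<open>V\<close> with a symmetric irreflexive adjacency relation \<open>E\<close>
  on \<open>V\<close>; each edge \<open>{v, w}\<close> is represented by both pairs \<open>(v, w)\<close> and \<open>(w, v)\<close>.
\<close>

definition simple_graph :: "'a set \<Rightarrow> ('a \<times> 'a) set \<Rightarrow> bool" where
  "simple_graph V E \<longleftrightarrow> E \<subseteq> V \<times> V \<and> sym E \<and> irrefl E"

definition neighbours :: "'a set \<Rightarrow> ('a \<times> 'a) set \<Rightarrow> 'a \<Rightarrow> 'a set" where
  "neighbours V E v = {w \<in> V. (v, w) \<in> E}"

definition locally_infinite :: "'a set \<Rightarrow> ('a \<times> 'a) set \<Rightarrow> bool" where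
  "locally_infinite V E \<longleftrightarrow> (\<forall>v\<in>V. infinite (neighbours V E v))"

text \<open>The values of \<open>f\<close> outside \<open>V\<close> are irrelevant.\<close>

definition graph_automorphism :: "'a set \<Rightarrow> ('a \<times> 'a) set \<Rightarrow> ('a \<Rightarrow> 'a) \<Rightarrow> bool" where
  "graph_automorphism V E f \<longleftrightarrow>
     bij_betw f V V \<and> (\<forall>v\<in>V. \<forall>w\<in>V. (f v, f w) \<in> E \<longleftrightarrow> (v, w) \<in> E)"

definition automorphism_invariant :: "'a set \<Rightarrow> ('a \<times> 'a) set \<Rightarrow> ('a \<times> 'a) set \<Rightarrow> bool" where
  "automorphism_invariant V E R \<longleftrightarrow>
     (\<forall>f. graph_automorphism V E f \<longrightarrow> (\<forall>v\<in>V. \<forall>w\<in>V. (f v, f w) \<in> R \<longleftrightarrow> (v, w) \<in> R))"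

definition primitive_graph :: "'a set \<Rightarrow> ('a \<times> 'a) set \<Rightarrow> bool" where
  "primitive_graph V E \<longleftrightarrow>
     (\<forall>R. equiv V R \<and> automorphism_invariant V E R \<longrightarrow> R = Id_on V \<or> R = V \<times> V)"

text \<open>
  \<open>(v, w) \<in> E ^^ n\<close> says that there is a walk of length \<open>n\<close> from \<open>v\<close> to \<open>w\<close>. The distance is \<open>\<infinity>\<close>
  if there is no walk, as the infimum of the empty set is \<open>\<infinity>\<close> in \<^typ>\<open>enat\<close>.
\<close>

definition graph_distance :: "('a \<times> 'a) set \<Rightarrow> 'a \<Rightarrow> 'a \<Rightarrow> enat" where
  "graph_distance E v w = (INF n\<in>{n. (v, w) \<in> E ^^ n}. enat n)"

definition graph_diameter :: "'a set \<Rightarrow> ('a \<times> 'a) set \<Rightarrow> enat" where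
  "graph_diameter V E = (SUP (v, w)\<in>V \<times> V. graph_distance E v w)"

text \<open>The \<open>i\<close>-th term of the distance sequence based at \<open>v\<close>, as a cardinal.\<close>

definition distance_sequence :: "'a set \<Rightarrow> ('a \<times> 'a) set \<Rightarrow> 'a \<Rightarrow> nat \<Rightarrow> 'a rel" where
  "distance_sequence V E v i = |{w \<in> V. graph_distance E v w = enat i}|"

end

(*
  If 1 \<le> i and some pair of vertices is at distance exactly i, then the equivalence relation generated
  by "being at distance exactly i" is invariant and not trivial, hence universal by primitivity. Its
  classes have at most max(d(i), \<aleph>_0) elements, so \<kappa> \<le> max(d(i), \<aleph>_0), and d(i) = \<kappa> because
  \<kappa> > \<aleph>_0. Such a pair exists for every i up to the diameter, since a geodesic between two points at
  distance at least i passes through a point at distance i.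
*)
theory Submission
  imports Defs
begin

section \<open>Walk lengths, distances and symmetric relations\<close>

lemma graph_distance_eq_enat_iff:
  "graph_distance E v w = enat k \<longleftrightarrow> (v, w) \<in> E ^^ k \<and> (\<forall>m<k. (v, w) \<notin> E ^^ m)"
proof
  assume eq: "graph_distance E v w = enat k"
  let ?S = "{n. (v, w) \<in> E ^^ n}"
  \<comment> \<open>Without any walk the infimum would be \<open>\<infinity>\<close> rather than a
    natural number.\<close>
  have ne: "enat ` ?S \<noteq> {}"
  proof
    assume "enat ` ?S = {}"
    then show False using eq by (simp add: graph_distance_def Inf_enat_def)
  qed
  \<comment> \<open>The order on \<open>enat\<close> is a well-order, so the infimum of a nonempty
    set is attained: the distance is the length of an actual walk.\<close>
  have "(LEAST x. x \<in> enat ` ?S) \<in> enat ` ?S"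
    using ne ex_in_conv LeastI_ex[of "\<lambda>x. x \<in> enat ` ?S"] by metis
  moreover have "(LEAST x. x \<in> enat ` ?S) = enat k"
    using eq unfolding graph_distance_def Inf_enat_def if_not_P[OF ne] .
  ultimately have "(v, w) \<in> E ^^ k" by (simp add: image_iff)
  moreover have "(v, w) \<notin> E ^^ m" if "m < k" for m
  proof
    assume "(v, w) \<in> E ^^ m"
    then have "graph_distance E v w \<le> enat m"
      unfolding graph_distance_def by (intro INF_lower) simp
    then show False using eq that by simp
  qed
  ultimately show "(v, w) \<in> E ^^ k \<and> (\<forall>m<k. (v, w) \<notin> E ^^ m)" by blast
next
  assume r: "(v, w) \<in> E ^^ k \<and> (\<forall>m<k. (v, w) \<notin> E ^^ m)"
  show "graph_distance E v w = enat k"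
    unfolding graph_distance_def
  proof (rule antisym)
    show "(INF n\<in>{n. (v, w) \<in> E ^^ n}. enat n) \<le> enat k"
      using r by (intro INF_lower) simp
    show "enat k \<le> (INF n\<in>{n. (v, w) \<in> E ^^ n}. enat n)"
      using r by (intro INF_greatest) (auto simp flip: not_less)
  qed
qed

lemma relpow_sym:
  assumes "sym R"
  shows "(x, y) \<in> R ^^ n \<longleftrightarrow> (y, x) \<in> R ^^ n"
proof (induction n arbitrary: x y)
  case (Suc n)
  have "(x, y) \<in> R ^^ Suc n \<longleftrightarrow> (\<exists>z. (x, z) \<in> R ^^ n \<and> (z, y) \<in> R)"
    by auto
  also have "\<dots> \<longleftrightarrow> (\<exists>z. (y, z) \<in> R \<and> (z, x) \<in> R ^^ n)"
    using Suc assms by (auto dest: symD)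
  also have "\<dots> \<longleftrightarrow> (y, x) \<in> R ^^ Suc n"
    by (meson relpow_Suc_D2 relpow_Suc_I2)
  finally show ?case .
qed auto

lemma relpow_subset_Times:
  assumes "R \<subseteq> V \<times> V" "0 < n"
  shows "R ^^ n \<subseteq> V \<times> V"
proof -
  have "R ^^ n \<subseteq> R\<^sup>+"
    using assms(2) by (auto simp: trancl_power)
  then show ?thesis using trancl_subset_Sigma[OF assms(1)] by blast
qed

text \<open>The restriction discards the reflexive pairs that \<open>R\<^sup>*\<close> has outside
  \<open>V\<close>.\<close>

lemma equiv_rtrancl_Restr:
  assumes "R \<subseteq> V \<times> V" "sym R"
  shows "equiv V (Restr (R\<^sup>*) V)"
  using sym_rtrancl[OF assms(2)]
  by (intro equivI) (auto simp: refl_on_def sym_def trans_def intro: rtrancl_trans)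

section \<open>Relations invariant under automorphisms\<close>

lemma automorphism_invariantD:
  "automorphism_invariant V E R \<Longrightarrow> graph_automorphism V E f \<Longrightarrow> v \<in> V \<Longrightarrow> w \<in> V \<Longrightarrow>
    (f v, f w) \<in> R \<longleftrightarrow> (v, w) \<in> R"
  by (auto simp: automorphism_invariant_def)

lemma graph_automorphism_image:
  "graph_automorphism V E f \<Longrightarrow> f ` V = V"
  by (auto simp: graph_automorphism_def bij_betw_def)

lemma automorphism_invariant_edges: "automorphism_invariant V E E"
  by (auto simp: automorphism_invariant_def graph_automorphism_def)

text \<open>An automorphism carries walks to walks. Conversely, every intermediate vertex of a walk
  between image points lies in \<open>V\<close>, hence has the form \<open>f u\<close>, so the walk
  pulls back.\<close>

lemma automorphism_invariant_relpow:
  assumes inv: "automorphism_invariant V E R" and R: "R \<subseteq> V \<times> V"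
  shows "automorphism_invariant V E (R ^^ n)"
  unfolding automorphism_invariant_def
proof (intro allI impI ballI)
  fix f v w
  assume f: "graph_automorphism V E f" and "v \<in> V" "w \<in> V"
  have fV: "f ` V = V" using f by (rule graph_automorphism_image)
  show "(f v, f w) \<in> R ^^ n \<longleftrightarrow> (v, w) \<in> R ^^ n"
    using \<open>w \<in> V\<close>
  proof (induction n arbitrary: w)
    case 0
    then show ?case
      using f \<open>v \<in> V\<close> by (auto simp: graph_automorphism_def bij_betw_def inj_on_def)
  next
    case (Suc n)
    have "(f v, f w) \<in> R ^^ Suc n \<longleftrightarrow> (\<exists>u\<in>f ` V. (f v, u) \<in> R ^^ n \<and> (u, f w) \<in> R)"
      unfolding fV using R by auto
    also have "\<dots> \<longleftrightarrow> (\<exists>u\<in>V. (v, u) \<in> R ^^ n \<and> (u, w) \<in> R)"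
      using Suc automorphism_invariantD[OF inv f] by auto
    also have "\<dots> \<longleftrightarrow> (v, w) \<in> R ^^ Suc n"
      using R by auto
    finally show ?case .
  qed
qed

lemma automorphism_invariant_rtrancl_Restr:
  assumes "automorphism_invariant V E R" "R \<subseteq> V \<times> V"
  shows "automorphism_invariant V E (Restr (R\<^sup>*) V)"
  unfolding automorphism_invariant_def
proof (intro allI impI ballI)
  fix f v w
  assume f: "graph_automorphism V E f" and vw: "v \<in> V" "w \<in> V"
  then have "f v \<in> V" "f w \<in> V"
    using graph_automorphism_image by blast+
  then show "(f v, f w) \<in> Restr (R\<^sup>*) V \<longleftrightarrow> (v, w) \<in> Restr (R\<^sup>*) V"
    using automorphism_invariantD[OF automorphism_invariant_relpow[OF assms] f vw] vw
    by (auto simp: rtrancl_power)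
qed

lemma graph_distance_automorphism:
  assumes "E \<subseteq> V \<times> V" "graph_automorphism V E f" "v \<in> V" "w \<in> V"
  shows "graph_distance E (f v) (f w) = graph_distance E v w"
  using automorphism_invariantD[OF
      automorphism_invariant_relpow[OF automorphism_invariant_edges assms(1)] assms(2-4)]
  by (simp add: graph_distance_def)

section \<open>The automorphism group and vertex-transitivity\<close>

lemma graph_automorphism_id: "graph_automorphism V E id"
  by (simp add: graph_automorphism_def)

lemma graph_automorphism_comp:
  assumes "graph_automorphism V E f" "graph_automorphism V E g"
  shows "graph_automorphism V E (g \<circ> f)"
proof -
  have "f v \<in> V" if "v \<in> V" for v
    using that graph_automorphism_image[OF assms(1)] by blast
  then show ?thesis
    using assms by (auto simp: graph_automorphism_def intro: bij_betw_trans)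
qed

lemma graph_automorphism_inv_into:
  assumes "graph_automorphism V E f"
  shows "graph_automorphism V E (inv_into V f)"
  unfolding graph_automorphism_def
proof (intro conjI ballI)
  have bij: "bij_betw f V V" using assms by (simp add: graph_automorphism_def)
  then show "bij_betw (inv_into V f) V V" by (rule bij_betw_inv_into)
  fix v w assume "v \<in> V" "w \<in> V"
  moreover from this have "inv_into V f v \<in> V" "inv_into V f w \<in> V"
    using bij by (metis bij_betw_imp_surj_on inv_into_into)+
  ultimately show "(inv_into V f v, inv_into V f w) \<in> E \<longleftrightarrow> (v, w) \<in> E"
    using assms bij_betw_inv_into_right[OF bij] \<open>v \<in> V\<close> \<open>w \<in> V\<close>
    unfolding graph_automorphism_def by fastforce
qed

definition orbit_relation :: "'a set \<Rightarrow> ('a \<times> 'a) set \<Rightarrow> ('a \<times> 'a) set" where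
  "orbit_relation V E = {(v, w). v \<in> V \<and> w \<in> V \<and> (\<exists>f. graph_automorphism V E f \<and> f v = w)}"

lemma orbit_relation_I:
  assumes "graph_automorphism V E f" "v \<in> V"
  shows "(v, f v) \<in> orbit_relation V E"
  using assms graph_automorphism_image[OF assms(1)] by (auto simp: orbit_relation_def)

lemma equiv_orbit_relation: "equiv V (orbit_relation V E)"
proof (intro equivI)
  show "orbit_relation V E \<subseteq> V \<times> V"
    by (auto simp: orbit_relation_def)
  show "refl_on V (orbit_relation V E)"
    using orbit_relation_I[OF graph_automorphism_id] by (auto simp: refl_on_def)
  show "sym (orbit_relation V E)"
  proof (rule symI)
    fix v w assume "(v, w) \<in> orbit_relation V E"
    then obtain f where f: "graph_automorphism V E f" "f v = w" "v \<in> V" "w \<in> V"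
      by (auto simp: orbit_relation_def)
    then have "inv_into V f w = v"
      by (auto simp: graph_automorphism_def bij_betw_def)
    then show "(w, v) \<in> orbit_relation V E"
      using orbit_relation_I[OF graph_automorphism_inv_into[OF f(1)] f(4)] by simp
  qed
  show "trans (orbit_relation V E)"
  proof (rule transI)
    fix u v w assume "(u, v) \<in> orbit_relation V E" "(v, w) \<in> orbit_relation V E"
    then obtain f g where "graph_automorphism V E f" "f u = v" "graph_automorphism V E g" "g v = w"
      and "u \<in> V" by (auto simp: orbit_relation_def)
    then show "(u, w) \<in> orbit_relation V E"
      using orbit_relation_I[OF graph_automorphism_comp, of V E f g u] by simp
  qed
qed

text \<open>An automorphism moves each vertex within its own orbit, so membership in a common orbit
  is unaffected.\<close>

lemma automorphism_invariant_orbit_relation: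
  "automorphism_invariant V E (orbit_relation V E)"
  unfolding automorphism_invariant_def
proof (intro allI impI ballI)
  fix f v w
  assume "graph_automorphism V E f" "v \<in> V" "w \<in> V"
  then have "(v, f v) \<in> orbit_relation V E" "(w, f w) \<in> orbit_relation V E"
    by (auto intro: orbit_relation_I)
  then show "(f v, f w) \<in> orbit_relation V E \<longleftrightarrow> (v, w) \<in> orbit_relation V E"
    using equiv_orbit_relation[of V E] by (meson equivE symE transE)
qed

text \<open>Primitivity leaves two options for the orbit relation. If it were equality, every
  automorphism would fix every vertex, so every equivalence relation would be invariant; three
  distinct vertices then allow a nontrivial one.\<close>

lemma primitive_graph_transitive:
  assumes prim: "primitive_graph V E" and inf: "infinite V" and "v \<in> V" "w \<in> V"
  obtains f where "graph_automorphism V E f" "f v = w"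
proof -
  have "orbit_relation V E \<noteq> Id_on V"
  proof
    assume triv: "orbit_relation V E = Id_on V"
    have fix_pts: "f x = x" if "graph_automorphism V E f" "x \<in> V" for f x
      using orbit_relation_I[OF that] triv by auto
    obtain a where a: "a \<in> V" using inf by fastforce
    obtain b where b: "b \<in> V" "b \<noteq> a"
      using inf by (metis finite.simps insertCI subsetI subset_singletonD)
    have "V - {a, b} \<noteq> {}" using inf by (metis finite.simps finite_Diff2)
    then obtain c where c: "c \<in> V" "c \<noteq> a" "c \<noteq> b" by blast
    \<comment> \<open>The classes are \<open>{a, b}\<close> and singletons: \<open>b\<close>
      separates this from equality, \<open>c\<close> from the universal relation.\<close>
    let ?R = "Id_on V \<union> {(a, b), (b, a)}"
    have "equiv V ?R"
      using a b by (intro equivI) (auto simp: refl_on_def sym_def trans_def)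
    moreover have "automorphism_invariant V E ?R"
      unfolding automorphism_invariant_def by (intro allI impI ballI) (simp only: fix_pts)
    ultimately have "?R = Id_on V \<or> ?R = V \<times> V"
      using prim unfolding primitive_graph_def by blast
    moreover have "?R \<noteq> Id_on V" using b by auto
    moreover have "?R \<noteq> V \<times> V" using a c by auto
    ultimately show False by blast
  qed
  then have "orbit_relation V E = V \<times> V"
    using prim equiv_orbit_relation automorphism_invariant_orbit_relation
    unfolding primitive_graph_def by blast
  then have "(v, w) \<in> orbit_relation V E" using assms by blast
  then show ?thesis using that by (auto simp: orbit_relation_def)
qed

section \<open>Closures of invariant relations and the size of their classes\<close>

lemma primitive_graph_rtrancl_universal:
  assumes "primitive_graph V E" "automorphism_invariant V E R" "R \<subseteq> V \<times> V" "sym R"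
    and "(v, w) \<in> R" "v \<noteq> w"
  shows "V \<times> V \<subseteq> R\<^sup>*"
proof -
  have "Restr (R\<^sup>*) V = Id_on V \<or> Restr (R\<^sup>*) V = V \<times> V"
    using assms(1) equiv_rtrancl_Restr[OF assms(3,4)]
      automorphism_invariant_rtrancl_Restr[OF assms(2,3)]
    unfolding primitive_graph_def by blast
  \<comment> \<open>A single off-diagonal pair excludes equality, leaving the universal
    relation.\<close>
  moreover have "(v, w) \<in> Restr (R\<^sup>*) V" "(v, w) \<notin> Id_on V" using assms by auto
  ultimately show ?thesis by blast
qed

text \<open>Points reachable in \<open>n + 1\<close> steps form a union of at most
  \<open>|B|\<close> sets of size at most \<open>|B|\<close>; the closure is then a countable union
  of such layers. An infinite cardinal absorbs both unions.\<close>

lemma card_of_rtrancl_Image_ordLeq: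
  assumes "infinite B" and bound: "\<And>x. |R `` {x}| \<le>o |B|"
  shows "|R\<^sup>* `` {v}| \<le>o |B|"
proof -
  have pow: "|(R ^^ n) `` {v}| \<le>o |B|" for n
  proof (induction n)
    case 0
    have "B \<noteq> {}" using assms(1) by auto
    then show ?case by (simp add: card_of_singl_ordLeq)
  next
    case (Suc n)
    have eq: "(R ^^ Suc n) `` {v} = (\<Union>x\<in>(R ^^ n) `` {v}. R `` {x})" by auto
    show ?case
      unfolding eq using assms(1) Suc bound by (intro card_of_UNION_ordLeq_infinite) auto
  qed
  have eq: "R\<^sup>* `` {v} = (\<Union>n. (R ^^ n) `` {v})" by (auto simp: rtrancl_power)
  have "|UNIV :: nat set| \<le>o |B|"
    using assms(1) infinite_iff_card_of_nat by blast
  then show ?thesis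
    unfolding eq using assms(1) pow by (intro card_of_UNION_ordLeq_infinite) auto
qed

section \<open>Spheres of a fixed radius as images under one invariant relation\<close>

definition distance_relation :: "'a set \<Rightarrow> ('a \<times> 'a) set \<Rightarrow> nat \<Rightarrow> ('a \<times> 'a) set" where
  "distance_relation V E i = {(v, w). v \<in> V \<and> w \<in> V \<and> graph_distance E v w = enat i}"

lemma sym_distance_relation:
  assumes "sym E"
  shows "sym (distance_relation V E i)"
  using relpow_sym[OF assms]
  by (auto simp: sym_def distance_relation_def graph_distance_eq_enat_iff)

lemma automorphism_invariant_distance_relation:
  assumes "E \<subseteq> V \<times> V"
  shows "automorphism_invariant V E (distance_relation V E i)"
  unfolding automorphism_invariant_def
proof (intro allI impI ballI)
  fix f v w
  assume f: "graph_automorphism V E f" and vw: "v \<in> V" "w \<in> V"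
  then have "f v \<in> V" "f w \<in> V"
    using graph_automorphism_image by blast+
  then show "(f v, f w) \<in> distance_relation V E i \<longleftrightarrow> (v, w) \<in> distance_relation V E i"
    using graph_distance_automorphism[OF assms f vw] vw by (simp add: distance_relation_def)
qed

lemma distance_sequence_conv_distance_relation:
  "v \<in> V \<Longrightarrow> distance_sequence V E v i = |distance_relation V E i `` {v}|"
  unfolding distance_sequence_def
  by (rule arg_cong[where f = card_of]) (auto simp: distance_relation_def)

text \<open>Since \<open>f\<close> preserves distances, it injects the sphere about \<open>v\<close>
  into the sphere of the same radius about \<open>f v\<close>.\<close>

lemma card_of_sphere_automorphism_ordLeq:
  assumes E: "E \<subseteq> V \<times> V" and f: "graph_automorphism V E f" and v: "v \<in> V"
  shows "|distance_relation V E i `` {v}| \<le>o |distance_relation V E i `` {f v}|"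
proof (rule card_of_ordLeqI)
  show "inj_on f (distance_relation V E i `` {v})"
    using f by (auto simp: graph_automorphism_def bij_betw_def distance_relation_def
        intro: inj_on_subset)
  show "f w \<in> distance_relation V E i `` {f v}" if "w \<in> distance_relation V E i `` {v}" for w
    using that v automorphism_invariantD[OF automorphism_invariant_distance_relation[OF E] f]
    by (auto simp: distance_relation_def)
qed

lemma distance_sequence_ordIso:
  fixes \<kappa> :: "'k rel"
  assumes card: "Card_order \<kappa>" "natLeq <o \<kappa>" "|V| =o \<kappa>"
    and graph: "simple_graph V E" and prim: "primitive_graph V E"
    and "0 < i" and ab: "(a, b) \<in> distance_relation V E i" and v: "v \<in> V"
  shows "distance_sequence V E v i =o \<kappa>"
proof (rule ccontr)
  let ?D = "distance_relation V E i"
  \<comment> \<open>The summand \<open>nat\<close> keeps \<open>?B\<close> infinite even if the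
    sphere is finite. As \<open>V\<close> is uncountable, \<open>?B\<close> is still smaller than
    \<open>V\<close> whenever the sphere is.\<close>
  let ?B = "?D `` {v} <+> (UNIV :: nat set)"
  assume neq: "\<not> distance_sequence V E v i =o \<kappa>"
  have E: "E \<subseteq> V \<times> V" "sym E" using graph by (auto simp: simple_graph_def)
  have nat: "|UNIV :: nat set| <o |V|"
    using card by (meson card_of_nat ordIso_ordLess_trans ordIso_symmetric ordLess_ordIso_trans)
  have inf: "infinite V"
    using nat by (meson infinite_iff_card_of_nat ordLess_imp_ordLeq)
  have DV: "?D \<subseteq> V \<times> V" by (auto simp: distance_relation_def)
  have "|?D `` {v}| \<le>o |V|" using DV by (intro card_of_mono1) auto
  moreover have "\<not> |?D `` {v}| =o |V|"
    using neq card(3) ordIso_transitive v by (auto simp: distance_sequence_conv_distance_relation)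
  ultimately have "|?D `` {v}| <o |V|" by (simp add: ordLeq_iff_ordLess_or_ordIso)
  then have less: "|?B| <o |V|"
    using card_of_Plus_ordLess_infinite[OF inf] nat by blast
  have infB: "infinite ?B" by simp
  \<comment> \<open>Vertex-transitivity transfers the bound from \<open>v\<close> to every centre in
    \<open>V\<close>; outside \<open>V\<close> the image is empty.\<close>
  have bound: "|?D `` {x}| \<le>o |?B|" for x
  proof (cases "x \<in> V")
    case True
    then obtain f where f: "graph_automorphism V E f" "f x = v"
      using primitive_graph_transitive[OF prim inf True v] by blast
    have "|?D `` {x}| \<le>o |?D `` {v}|"
      using card_of_sphere_automorphism_ordLeq[OF E(1) f(1) True] f(2) by simp
    then show ?thesis using card_of_Plus1 ordLeq_transitive by blast
  next
    case False
    then have "?D `` {x} = {}" by (auto simp: distance_relation_def)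
    then show ?thesis by (metis card_of_empty)
  qed
  \<comment> \<open>Positive distance: the walk of length 0 is excluded.\<close>
  have "a \<noteq> b"
    using ab \<open>0 < i\<close> by (auto simp: distance_relation_def graph_distance_eq_enat_iff)
  then have "V \<times> V \<subseteq> ?D\<^sup>*"
    using primitive_graph_rtrancl_universal[OF prim automorphism_invariant_distance_relation DV
        sym_distance_relation ab] E by blast
  then have "V \<subseteq> ?D\<^sup>* `` {v}" using v by blast
  \<comment> \<open>All of \<open>V\<close> is the class of \<open>v\<close>, whose size is bounded
    by \<open>|?B|\<close>, against \<open>less\<close>.\<close>
  then have "|V| \<le>o |?B|"
    using card_of_rtrancl_Image_ordLeq[OF infB bound] card_of_mono1 ordLeq_transitive by blast
  then show False using less not_ordLess_ordLeq by blast
qed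

text \<open>Cutting a geodesic of length at least \<open>i\<close> after \<open>i\<close> steps
  gives a vertex at distance \<open>i\<close> from its start.\<close>

lemma distance_relation_nonempty:
  assumes conn: "V \<times> V \<subseteq> E\<^sup>*" and E: "E \<subseteq> V \<times> V"
    and "0 < i" and diam: "enat i \<le> graph_diameter V E"
  obtains a b where "(a, b) \<in> distance_relation V E i"
proof -
  have "\<exists>(v, w)\<in>V \<times> V. enat i \<le> graph_distance E v w"
  proof (rule ccontr)
    assume "\<not> ?thesis"
    then have "graph_distance E v w < enat i" if "v \<in> V" "w \<in> V" for v w
      using that by (auto simp: not_le)
    \<comment> \<open>The strict bound becomes a weak one, which passes to the supremum;
      \<open>0 < i\<close> makes \<open>i - 1\<close> a true predecessor.\<close>
    then have "graph_distance E v w \<le> enat (i - 1)" if "v \<in> V" "w \<in> V" for v w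
      using that \<open>0 < i\<close> by (cases "graph_distance E v w") fastforce+
    then have "graph_diameter V E \<le> enat (i - 1)"
      unfolding graph_diameter_def by (intro SUP_least) auto
    then have "enat i \<le> enat (i - 1)" using diam by (rule order_trans[rotated])
    then show False using \<open>0 < i\<close> by simp
  qed
  then obtain v w where vw: "v \<in> V" "w \<in> V" "enat i \<le> graph_distance E v w" by auto
  \<comment> \<open>Connectivity excludes the value \<open>\<infinity>\<close>, which the lower
    bound on the distance alone would allow.\<close>
  then have ex: "\<exists>k. (v, w) \<in> E ^^ k"
    using conn rtrancl_imp_relpow by blast
  define k where "k = (LEAST k. (v, w) \<in> E ^^ k)"
  have k: "(v, w) \<in> E ^^ k" and min: "\<And>m. m < k \<Longrightarrow> (v, w) \<notin> E ^^ m"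
    using LeastI_ex[OF ex] not_less_Least unfolding k_def by blast+
  then have "graph_distance E v w = enat k" by (simp add: graph_distance_eq_enat_iff)
  then have "i \<le> k" using vw by simp
  then have "(v, w) \<in> E ^^ i O E ^^ (k - i)"
    using k by (metis le_add_diff_inverse relpow_add)
  then obtain u where u: "(v, u) \<in> E ^^ i" "(u, w) \<in> E ^^ (k - i)" by blast
  \<comment> \<open>A shortcut to \<open>u\<close> followed by the rest of the geodesic would reach
    \<open>w\<close> in fewer than \<open>k\<close> steps.\<close>
  have "(v, u) \<notin> E ^^ m" if "m < i" for m
  proof
    assume "(v, u) \<in> E ^^ m"
    then have "(v, w) \<in> E ^^ (m + (k - i))" using u(2) by (auto simp: relpow_add)
    then show False using min[of "m + (k - i)"] that \<open>i \<le> k\<close> by linarith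
  qed
  then have "graph_distance E v u = enat i" using u by (simp add: graph_distance_eq_enat_iff)
  moreover have "u \<in> V" using u(1) relpow_subset_Times[OF E \<open>0 < i\<close>] by blast
  ultimately show ?thesis using that vw by (auto simp: distance_relation_def)
qed

section \<open>The terms of the distance sequence\<close>

lemma distance_sequence_0:
  assumes "v \<in> V"
  shows "distance_sequence V E v 0 =o cone"
proof -
  have "{w \<in> V. graph_distance E v w = enat 0} = {v}"
    using assms by (auto simp: graph_distance_eq_enat_iff)
  then show ?thesis
    unfolding distance_sequence_def cone_def
    by (intro card_of_ordIsoI[of "\<lambda>_. ()"]) (simp add: bij_betw_def)
qed

theorem theorem1p9:
  fixes V :: "'a set" and E :: "('a \<times> 'a) set" and \<kappa> :: "'k rel"
  assumes "Card_order \<kappa>" and "natLeq <o \<kappa>"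
    and "simple_graph V E" and "locally_infinite V E" and "primitive_graph V E"
    and "|V| =o \<kappa>"
  shows "(graph_diameter V E = \<infinity> \<longrightarrow>
            (\<forall>v\<in>V. distance_sequence V E v 0 =o cone \<and>
              (\<forall>i\<ge>1. distance_sequence V E v i =o \<kappa>))) \<and>
         (\<forall>n::nat. graph_diameter V E = enat n \<longrightarrow>
            (\<forall>v\<in>V. distance_sequence V E v 0 =o cone \<and>
              (\<forall>i\<in>{1..n}. distance_sequence V E v i =o \<kappa>)))"
proof -
  have E: "E \<subseteq> V \<times> V" "sym E" "irrefl E"
    using assms(3) by (auto simp: simple_graph_def)
  \<comment> \<open>The bound in \<open>enat\<close> covers both cases: it holds for every
    \<open>i\<close> if the diameter is \<open>\<infinity>\<close>, and for \<open>i \<le> n\<close>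
    if it is \<open>n\<close>.\<close>
  have sphere: "distance_sequence V E v i =o \<kappa>"
    if v: "v \<in> V" and i: "1 \<le> i" "enat i \<le> graph_diameter V E" for v i
  proof -
    \<comment> \<open>Local infinitude supplies an edge, whose ends differ by irreflexivity;
      primitivity applied to \<open>E\<close> itself then gives connectivity.\<close>
    obtain w where "(v, w) \<in> E"
      using assms(4) v unfolding locally_infinite_def neighbours_def
      by (metis (no_types, lifting) Collect_empty_eq finite.emptyI)
    moreover from this have "v \<noteq> w" using E(3) by (auto simp: irrefl_def)
    ultimately have "V \<times> V \<subseteq> E\<^sup>*"
      using primitive_graph_rtrancl_universal[OF assms(5) automorphism_invariant_edges E(1,2)]
      by blast
    then obtain a b where "(a, b) \<in> distance_relation V E i"
      using distance_relation_nonempty[OF _ E(1) _ i(2)] i(1) by auto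
    then show ?thesis
      using distance_sequence_ordIso[OF assms(1,2,6,3,5)] i(1) v by simp
  qed
  then show ?thesis by (auto intro: distance_sequence_0)
qed

end
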